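(* Let $n\ge 2$ and $p\ge 1$ be integers and let $\mathcal{M}_{n,p}$ denote the set of (simple) bipartite graphs on $n$ vertices whose matching number equals $p$. Then, up to isomorphism, the complete bipartite graph $K_{p,n-p}$ is the unique graph in $\mathcal{M}_{n,p}$ with maximum Estrada index; that is, $EE(G)\le EE(K_{p,n-p})$ for every $G\in\mathcal{M}_{n,p}$, with equality if and only if $G\cong K_{p,n-p}$.
   Context: For a simple graph $G$ on $n$ vertices with adjacency eigenvalues $\lambda_1\ge\cdots\ge\lambda_n$, the Estrada index is $EE(G)=\sum_{i=1}^n e^{\lambda_i}$. The matching number of $G$ is the number of edges in a maximum matching (set of pairwise nonadjacent edges) of $G$. $K_{a,b}$ denotes the complete bipartite graph with parts of sizes $a$ and $b$. *)

theory Defs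
  imports
    Complex_Main
    "HOL-Library.Countable_Set"
    "HOL-Computational_Algebra.Polynomial"
    "Jordan_Normal_Form.Char_Poly"
    "Graph_Theory.Graph_Theory"
begin

text \<open>
  A finite simple graph is a digraph satisfying the locale predicate \<open>graph\<close>: finite,
  loop-free, without parallel arcs, and symmetric. An edge \<open>uv\<close> is thus represented by one
  arc from \<open>u\<close> to \<open>v\<close> and one from \<open>v\<close> to \<open>u\<close>.
\<close>

definition bipartite :: "('a, 'b) pre_digraph \<Rightarrow> bool" where
  "bipartite G \<longleftrightarrow> (\<exists>U V. verts G = U \<union> V \<and> U \<inter> V = {} \<and>
     arcs_ends G \<subseteq> U \<times> V \<union> V \<times> U)"

definition edges :: "('a, 'b) pre_digraph \<Rightarrow> 'a set set" where
  "edges G = {{u, v} | u v. (u, v) \<in> arcs_ends G}"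

definition matching :: "('a, 'b) pre_digraph \<Rightarrow> 'a set set \<Rightarrow> bool" where
  "matching G M \<longleftrightarrow> M \<subseteq> edges G \<and> pairwise disjnt M"

definition matching_number :: "('a, 'b) pre_digraph \<Rightarrow> nat" where
  "matching_number G = Max {card M | M. matching G M}"

text \<open>
  The vertices are numbered by the enumeration \<open>from_nat_into (verts G)\<close>, which for a finite
  vertex set is a bijection from \<open>{..<card (verts G)}\<close>. Another numbering conjugates the
  matrix by a permutation matrix and leaves its characteristic polynomial unchanged.
\<close>

definition adjacency_matrix :: "('a, 'b) pre_digraph \<Rightarrow> real mat" where
  "adjacency_matrix G = mat (card (verts G)) (card (verts G))
     (\<lambda>(i, j). if (from_nat_into (verts G) i, from_nat_into (verts G) j) \<in> arcs_ends G
                then 1 else 0)"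

text \<open>
  The adjacency matrix is real symmetric, so its characteristic polynomial splits over the
  reals and the multiset of its real roots consists of all \<open>n\<close> eigenvalues with multiplicity.
\<close>

definition adjacency_eigenvalues :: "('a, 'b) pre_digraph \<Rightarrow> real multiset" where
  "adjacency_eigenvalues G = proots (char_poly (adjacency_matrix G))"

definition estrada_index :: "('a, 'b) pre_digraph \<Rightarrow> real" where
  "estrada_index G = (\<Sum>\<^sub># (image_mset exp (adjacency_eigenvalues G)))"

definition bipartite_graphs_matching :: "nat \<Rightarrow> nat \<Rightarrow> ('a, 'b) pre_digraph set" where
  "bipartite_graphs_matching n p =
     {G. graph G \<and> bipartite G \<and> card (verts G) = n \<and> matching_number G = p}"

lemma complete_bipartite_digraph_exists:
  "\<exists>K :: nat pair_pre_digraph. complete_bipartite_digraph a b (with_proj K)"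
proof -
  let ?U = "{..<a}" and ?V = "{a..<a + b}"
  let ?K = "\<lparr>pverts = ?U \<union> ?V, parcs = ?U \<times> ?V \<union> ?V \<times> ?U\<rparr>"
  have "complete_bipartite_digraph a b (with_proj ?K)"
    unfolding complete_bipartite_digraph_pair_def
    by (intro conjI exI[of _ ?U] exI[of _ ?V]) auto
  then show ?thesis by blast
qed

end

theory Submission
  imports Defs "Jordan_Normal_Form.Schur_Decomposition" "HOL-Number_Theory.Cong"
begin

text \<open>
  The spectrum of a bipartite graph with \<open>m\<close> edges is symmetric about \<open>0\<close> and has square sum
  \<open>2m\<close>. Since \<open>(cosh x - 1) / x\<^sup>2\<close> increases with \<open>\<bar>x\<bar>\<close> and every eigenvalue satisfies
  \<open>x\<^sup>2 \<le> m\<close>, the Estrada index is at most \<open>n + 2 (cosh (sqrt m) - 1)\<close>, with equality for complete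
  bipartite graphs, which have the eigenvalues \<open>\<plusminus> sqrt m\<close>. On the other hand the pairs
  in \<open>U \<times> V\<close> are partitioned into \<open>max |U| |V|\<close> matchings, each of which contains at most \<open>p\<close>
  edges of a graph with matching number \<open>p\<close>; as \<open>|U|\<close> and \<open>|V|\<close> are at least \<open>p\<close>, this yields
  \<open>m \<le> p (n - p)\<close>, with equality only for \<open>K\<^bsub>p,n-p\<^esub>\<close>.
\<close>

subsection \<open>Spectra of real symmetric matrices\<close>

lemma proots_prod_list_linear:
  "proots (\<Prod>a\<leftarrow>as. [:- a, 1:]) = mset (as :: 'a :: idom list)"
proof (induction as)
  case (Cons a as)
  have "(\<Prod>a\<leftarrow>as. [:- a, 1:]) \<noteq> 0"
    by (auto simp: prod_list_zero_iff)
  then have "proots ([:- a, 1:] * (\<Prod>a\<leftarrow>as. [:- a, 1:])) = {#a#} + mset as"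
    by (subst proots_mult) (auto simp: Cons)
  then show ?case by (simp del: mult_pCons_left)
qed simp

text \<open>Cyclicity of the trace, also for rectangular factors; it makes the trace of a square
  invariant under similarity.\<close>

lemma sum_diag_mult_commute:
  fixes A B :: "'a :: comm_semiring_0 mat"
  assumes "A \<in> carrier_mat n m" "B \<in> carrier_mat m n"
  shows "(\<Sum>i<n. (A * B) $$ (i, i)) = (\<Sum>i<m. (B * A) $$ (i, i))"
proof -
  have "(\<Sum>i<n. (A * B) $$ (i, i)) = (\<Sum>i<n. \<Sum>j<m. A $$ (i, j) * B $$ (j, i))"
    using assms by (intro sum.cong) (auto simp: scalar_prod_def atLeast0LessThan)
  also have "\<dots> = (\<Sum>j<m. \<Sum>i<n. B $$ (j, i) * A $$ (i, j))"
    by (subst sum.swap) (simp add: mult.commute)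
  also have "\<dots> = (\<Sum>i<m. (B * A) $$ (i, i))"
    using assms by (intro sum.cong) (auto simp: scalar_prod_def atLeast0LessThan)
  finally show ?thesis .
qed

text \<open>For an eigenvector \<open>v\<close> the form \<open>S\<close>, that is
  \<open>v* A v\<close>, is its own conjugate because \<open>A\<close> is real and symmetric. It
  also equals \<open>l\<close> times the squared norm \<open>N > 0\<close>, so \<open>l\<close> is a
  quotient of reals.\<close>

lemma eigenvalue_real_symmetric_in_Reals:
  fixes A :: "real mat"
  assumes A: "A \<in> carrier_mat n n"
    and sym: "\<And>i j. i < n \<Longrightarrow> j < n \<Longrightarrow> A $$ (i, j) = A $$ (j, i)"
    and ev: "eigenvalue (map_mat complex_of_real A) l"
  shows "l \<in> \<real>"
proof -
  obtain v where v: "v \<in> carrier_vec n" "v \<noteq> 0\<^sub>v n"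
    and Av: "map_mat complex_of_real A *\<^sub>v v = l \<cdot>\<^sub>v v"
    using ev A unfolding eigenvalue_def eigenvector_def by auto
  define S where "S = (\<Sum>i<n. \<Sum>j<n. of_real (A $$ (i, j)) * (v $ j * cnj (v $ i)))"
  define N where "N = (\<Sum>i<n. (cmod (v $ i))\<^sup>2)"
  have row: "(\<Sum>j<n. of_real (A $$ (i, j)) * v $ j) = l * v $ i" if "i < n" for i
    using arg_cong[OF Av, of "\<lambda>x. x $ i"] that A v(1)
    by (simp add: scalar_prod_def atLeast0LessThan)
  have "S = (\<Sum>i<n. (\<Sum>j<n. of_real (A $$ (i, j)) * v $ j) * cnj (v $ i))"
    unfolding S_def by (simp add: sum_distrib_right mult.assoc)
  also have "\<dots> = (\<Sum>i<n. l * of_real ((cmod (v $ i))\<^sup>2))"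
    by (intro sum.cong) (simp_all add: row mult.assoc del: of_real_power flip: complex_norm_square)
  also have "\<dots> = l * of_real N"
    by (simp add: N_def sum_distrib_left)
  finally have SN: "S = l * of_real N" .
  have "cnj S = (\<Sum>i<n. \<Sum>j<n. of_real (A $$ (i, j)) * (cnj (v $ j) * v $ i))"
    by (simp add: S_def)
  also have "\<dots> = (\<Sum>j<n. \<Sum>i<n. of_real (A $$ (i, j)) * (cnj (v $ j) * v $ i))"
    by (rule sum.swap)
  also have "\<dots> = S"
    unfolding S_def by (intro sum.cong) (simp_all add: sym mult.commute)
  finally have S: "S \<in> \<real>"
    by (simp add: Reals_cnj_iff)
  obtain i where i: "i < n" "v $ i \<noteq> 0"
    using v by (metis carrier_vecD eq_vecI index_zero_vec)
  have "N > 0"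
    unfolding N_def using i by (intro sum_pos2[of _ i]) auto
  then have "l = S / of_real N"
    by (simp add: SN)
  with S show ?thesis by simp
qed

text \<open>The polynomial factors over the complex numbers with real roots only. The factorization
  descends to the reals because the embedding of polynomials is injective.\<close>

lemma char_poly_real_symmetric_splits:
  fixes A :: "real mat"
  assumes A: "A \<in> carrier_mat n n"
    and sym: "\<And>i j. i < n \<Longrightarrow> j < n \<Longrightarrow> A $$ (i, j) = A $$ (j, i)"
  obtains es where "char_poly A = (\<Prod>a\<leftarrow>es. [:- a, 1:])" "length es = n"
proof -
  let ?C = "map_mat complex_of_real A"
  have C: "?C \<in> carrier_mat n n" using A by simp
  obtain as where as: "char_poly ?C = (\<Prod>a\<leftarrow>as. [:- a, 1:])" "length as = n"
    using char_poly_factorized[OF C] by blast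
  have real: "a \<in> \<real>" if "a \<in> set as" for a
  proof (rule eigenvalue_real_symmetric_in_Reals[OF A sym])
    show "eigenvalue ?C a"
      unfolding eigenvalue_root_char_poly[OF C] as using that
      by (auto simp: poly_prod_list prod_list_zero_iff)
  qed
  define es where "es = map Re as"
  have as_es: "as = map complex_of_real es"
    unfolding es_def using real by (simp add: map_idI)
  interpret hom: map_poly_inj_idom_hom complex_of_real ..
  have "map_poly complex_of_real (char_poly A) = char_poly ?C"
    by (rule of_real_hom.char_poly_hom[OF A, symmetric])
  also have "\<dots> = map_poly complex_of_real (\<Prod>a\<leftarrow>es. [:- a, 1:])"
    unfolding as(1) as_es
    by (simp add: hom.hom_prod_list o_def)
  finally have "char_poly A = (\<Prod>a\<leftarrow>es. [:- a, 1:])"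
    by simp
  with as(2) show ?thesis by (intro that[of es]) (simp_all add: es_def)
qed

text \<open>
  The Schur form of the matrix is triangular with the eigenvalues on the diagonal, so the
  trace of its square gives the second power sum, and its negative the spectrum of \<open>- A\<close>.
\<close>

lemma real_symmetric_spectrum:
  fixes A :: "real mat"
  assumes A: "A \<in> carrier_mat n n"
    and sym: "\<And>i j. i < n \<Longrightarrow> j < n \<Longrightarrow> A $$ (i, j) = A $$ (j, i)"
  shows size_proots_real_symmetric: "size (proots (char_poly A)) = n"
    and sum_squares_proots_real_symmetric:
      "(\<Sum>x\<in>#proots (char_poly A). x\<^sup>2) = (\<Sum>i<n. \<Sum>j<n. (A $$ (i, j))\<^sup>2)"
    and proots_uminus_real_symmetric:
      "proots (char_poly (- A)) = image_mset uminus (proots (char_poly A))"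
proof -
  obtain es where es: "char_poly A = (\<Prod>a\<leftarrow>es. [:- a, 1:])" "length es = n"
    using char_poly_real_symmetric_splits[OF A sym] by blast
  obtain B P Q where "schur_decomposition A es = (B, P, Q)"
    by (cases "schur_decomposition A es")
  from schur_decomposition[OF A es(1) this]
  have wit: "similar_mat_wit A B P Q" and ut: "upper_triangular B" and diag: "diag_mat B = es"
    by auto
  note w = similar_mat_witD2[OF A wit]
  have B: "B \<in> carrier_mat n n" using w by simp
  have proots: "proots (char_poly A) = mset es"
    unfolding es(1) by (rule proots_prod_list_linear)
  then show "size (proots (char_poly A)) = n"
    using es by simp
  have es_nth: "es = map (\<lambda>i. B $$ (i, i)) [0..<n]"
    using diag B by (auto simp: diag_mat_def)
  \<comment> \<open>Bracketed so that moving \<open>P\<close> to the end under the trace leaves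
    \<open>Q * P\<close>, which is the identity.\<close>
  have sq: "A * A = P * (B * B * Q)"
  proof -
    have "A * A = P * B * Q * (P * B * Q)" using w by simp
    also have "\<dots> = P * B * (Q * P) * (B * Q)"
      using w(4-7) by (simp add: assoc_mult_mat[of _ n n _ n _ n])
    also have "\<dots> = P * (B * B * Q)"
      unfolding w(2) using w(4-7) by (simp add: assoc_mult_mat[of _ n n _ n _ n])
    finally show ?thesis .
  qed
  have "(\<Sum>i<n. \<Sum>j<n. (A $$ (i, j))\<^sup>2) = (\<Sum>i<n. (A * A) $$ (i, i))"
    using A sym by (intro sum.cong) (auto simp: scalar_prod_def atLeast0LessThan power2_eq_square)
  also have "\<dots> = (\<Sum>i<n. (B * B * Q * P) $$ (i, i))"
    unfolding sq using w(4-7) by (intro sum_diag_mult_commute) auto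
  also have "B * B * Q * P = B * B * (Q * P)"
    using w(4-7) by (intro assoc_mult_mat) auto
  also have "B * B * (Q * P) = B * B"
    using w(2,5) by simp
  also have "(\<Sum>i<n. (B * B) $$ (i, i)) = (\<Sum>i<n. (B $$ (i, i))\<^sup>2)"
  proof (intro sum.cong refl)
    fix i assume "i \<in> {..<n}"
    then have i: "i < n" by simp
    have "(B * B) $$ (i, i) = (\<Sum>k<n. B $$ (i, k) * B $$ (k, i))"
      using i B by (auto simp: scalar_prod_def atLeast0LessThan)
    \<comment> \<open>For \<open>k \<noteq> i\<close> one of the two factors lies below the diagonal
      of \<open>B\<close> and vanishes.\<close>
    also have "\<dots> = (\<Sum>k<n. if k = i then (B $$ (i, i))\<^sup>2 else 0)"
    proof (intro sum.cong refl)
      fix k assume "k \<in> {..<n}"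
      then show "B $$ (i, k) * B $$ (k, i) = (if k = i then (B $$ (i, i))\<^sup>2 else 0)"
        using ut B i unfolding upper_triangular_def
        by (cases i k rule: linorder_cases) (auto simp: power2_eq_square)
    qed
    also have "\<dots> = (B $$ (i, i))\<^sup>2"
      using i by simp
    finally show "(B * B) $$ (i, i) = (B $$ (i, i))\<^sup>2" .
  qed
  also have "\<dots> = (\<Sum>x\<in>#mset es. x\<^sup>2)"
    unfolding es_nth
    by (simp add: sum_mset_sum_list o_def interv_sum_list_conv_sum_set_nat atLeast0LessThan
        flip: mset_map)
  finally show "(\<Sum>x\<in>#proots (char_poly A). x\<^sup>2) = (\<Sum>i<n. \<Sum>j<n. (A $$ (i, j))\<^sup>2)"
    by (simp add: proots)
  have "- A = P * (- B) * Q"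
    using w by simp
  then have "similar_mat (- A) (- B)"
    using w by (intro similar_matI[of _ _ P Q n]) auto
  then have "char_poly (- A) = char_poly (- B)"
    by (rule char_poly_similar)
  also have "\<dots> = (\<Prod>a\<leftarrow>diag_mat (- B). [:- a, 1:])"
    using B ut by (intro char_poly_upper_triangular[of _ n]) (auto simp: upper_triangular_def)
  also have "diag_mat (- B) = map uminus es"
    using B unfolding es_nth by (auto simp: diag_mat_def)
  finally show "proots (char_poly (- A)) = image_mset uminus (proots (char_poly A))"
    by (simp only: proots_prod_list_linear proots mset_map)
qed

subsection \<open>Exponential sums over symmetric multisets\<close>

text \<open>The power series are compared term by term. The cross-multiplied form avoids the
  quotient \<open>(cosh x - 1) / x^2\<close>, so \<open>x = 0\<close> is no exception.\<close>

lemma cosh_minus_one_ratio_mono: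
  fixes x s :: real
  assumes "\<bar>x\<bar> \<le> s"
  shows "s\<^sup>2 * (cosh x - 1) \<le> x\<^sup>2 * (cosh s - 1)"
proof -
  \<comment> \<open>The terms of the \<open>cosh\<close> series with the constant term
    removed.\<close>
  define c where "c y n = (if even n then y ^ n /\<^sub>R fact n else (0 :: real)) - (if n = 0 then 1 else 0)" for y n
  have c: "c y sums (cosh y - 1)" for y
    unfolding c_def[abs_def] by (intro sums_diff cosh_converges sums_single[of 0 "\<lambda>_. 1"])
  have "s\<^sup>2 * c x n \<le> x\<^sup>2 * c s n" for n
  proof (cases "even n \<and> n \<noteq> 0")
    case True
    \<comment> \<open>Splitting off one square from \<open>y ^ n\<close> leaves the comparison of
      \<open>(x^2) ^ k\<close> with \<open>(s^2) ^ k\<close>.\<close>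
    then obtain k where k: "n = 2 * Suc k"
      by (metis dvd_def mult_0_right not0_implies_Suc)
    have "x\<^sup>2 \<le> s\<^sup>2"
      using assms by (metis abs_ge_zero power_mono power2_abs)
    then have "(x\<^sup>2) ^ k * (x\<^sup>2 * s\<^sup>2) \<le> (s\<^sup>2) ^ k * (x\<^sup>2 * s\<^sup>2)"
      by (intro mult_right_mono power_mono[of "x\<^sup>2"]) auto
    moreover have "y ^ n = y\<^sup>2 * (y\<^sup>2) ^ k" for y :: real
      by (simp only: k power_mult power_Suc)
    ultimately have "s\<^sup>2 * x ^ n / fact n \<le> x\<^sup>2 * s ^ n / fact n"
      by (intro divide_right_mono) (simp_all only: fact_ge_zero mult_ac)
    then show ?thesis using True by (simp add: c_def divide_inverse mult_ac)
  qed (auto simp: c_def)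
  then show ?thesis
    by (rule sums_le[OF _ sums_mult[OF c] sums_mult[OF c]])
qed

text \<open>Averaging the sum with its reflection turns \<open>exp\<close> into \<open>cosh\<close>.
  Subtracting 1 leaves a summand that vanishes at 0 and is comparable with a multiple of
  \<open>x^2\<close>.\<close>

lemma sum_mset_exp_symmetric:
  fixes R :: "real multiset"
  assumes "image_mset uminus R = R"
  shows "(\<Sum>x\<in>#R. exp x) = real (size R) + (\<Sum>x\<in>#R. cosh x - 1)"
proof -
  have "(\<Sum>x\<in>#R. exp x) = (\<Sum>x\<in>#image_mset uminus R. exp x)"
    by (simp only: assms)
  then have "(\<Sum>x\<in>#R. exp x) = (\<Sum>x\<in>#R. exp (- x))"
    by (simp add: image_mset.compositionality o_def)
  moreover have "(\<Sum>x\<in>#R. exp x) + (\<Sum>x\<in>#R. exp (- x)) =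
      (real (size R) + (\<Sum>x\<in>#R. cosh x - 1)) + (real (size R) + (\<Sum>x\<in>#R. cosh x - 1))"
  proof (induction R)
    case (add x R)
    have "exp x + exp (- x) = cosh x + cosh x"
      by (simp add: cosh_field_def)
    with add show ?case by simp
  qed simp
  ultimately show ?thesis by linarith
qed

text \<open>As \<open>x \<noteq> 0\<close>, the values \<open>x\<close> and \<open>- x\<close> are
  two different members of \<open>R\<close>. Each contributes \<open>f x\<close>, and the remaining
  terms are nonnegative.\<close>

lemma even_fun_le_sum_mset_symmetric:
  fixes R :: "real multiset" and f :: "real \<Rightarrow> real"
  assumes R: "image_mset uminus R = R" and x: "x \<in># R" "x \<noteq> 0"
    and f: "\<And>y. 0 \<le> f y" "\<And>y. f (- y) = f y"
  shows "2 * f x \<le> (\<Sum>y\<in>#R. f y)"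
proof -
  obtain R' where R': "R = add_mset x R'"
    using x(1) by (metis multi_member_split)
  have "- x \<in># R"
    using x(1) R by (metis image_eqI set_image_mset)
  then have "- x \<in># R'"
    using x(2) by (simp add: R')
  then obtain R'' where "R' = add_mset (- x) R''"
    by (metis multi_member_split)
  moreover have "0 \<le> (\<Sum>y\<in>#R''. f y)"
    by (induction R'') (simp_all add: f)
  ultimately show ?thesis
    by (simp add: R' f)
qed

text \<open>A nonzero \<open>x\<close> occurs together with \<open>- x\<close>, so
  \<open>2 x^2 \<le> 2 m\<close> and \<open>\<bar>x\<bar> \<le> sqrt m\<close>. The ratio bound then
  gives \<open>m (cosh x - 1) \<le> x^2 (cosh (sqrt m) - 1)\<close>, which is summed over
  \<open>R\<close>.\<close>

lemma sum_mset_exp_symmetric_le: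
  fixes R :: "real multiset" and m :: real
  assumes R: "image_mset uminus R = R" and sq: "(\<Sum>x\<in>#R. x\<^sup>2) = 2 * m"
  shows "(\<Sum>x\<in>#R. exp x) \<le> real (size R) + 2 * (cosh (sqrt m) - 1)"
proof -
  have "0 \<le> (\<Sum>x\<in>#R. x\<^sup>2)"
    by (induction R) simp_all
  then have m: "0 \<le> m" by (simp add: sq)
  have le: "m * (cosh x - 1) \<le> x\<^sup>2 * (cosh (sqrt m) - 1)" if "x \<in># R" for x
  proof -
    have "x\<^sup>2 \<le> m"
      using even_fun_le_sum_mset_symmetric[OF R that, of "\<lambda>x. x\<^sup>2"] sq m by (cases "x = 0") auto
    then have "\<bar>x\<bar> \<le> sqrt m"
      by (metis real_sqrt_abs real_sqrt_le_iff)
    from cosh_minus_one_ratio_mono[OF this] show ?thesis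
      using m by simp
  qed
  have "(\<Sum>x\<in>#R. cosh x - 1) \<le> 2 * (cosh (sqrt m) - 1)"
  \<comment> \<open>The summed inequality is divided by \<open>m\<close>; for \<open>m = 0\<close>
    all members of \<open>R\<close> are 0 instead.\<close>
  proof (cases "m = 0")
    case True
    have "x = 0" if "x \<in># R" for x
      using even_fun_le_sum_mset_symmetric[OF R that, of "\<lambda>x. x\<^sup>2"] sq True by (cases "x = 0") auto
    then have "image_mset (\<lambda>x. cosh x - 1) R = image_mset (\<lambda>_. 0) R"
      by (intro image_mset_cong) simp
    then show ?thesis by (simp add: True)
  next
    case False
    have "m * (\<Sum>x\<in>#R. cosh x - 1) = (\<Sum>x\<in>#R. m * (cosh x - 1))"
      by (simp add: sum_mset_distrib_left image_mset.compositionality o_def)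
    also have "\<dots> \<le> (\<Sum>x\<in>#R. x\<^sup>2 * (cosh (sqrt m) - 1))"
      by (intro sum_mset_mono le)
    also have "\<dots> = m * (2 * (cosh (sqrt m) - 1))"
      by (simp add: sq flip: sum_mset_distrib_right)
    finally show ?thesis
      using m False by (metis less_eq_real_def mult_le_cancel_left_pos)
  qed
  then show ?thesis
    by (simp add: sum_mset_exp_symmetric[OF R])
qed

text \<open>The pair \<open>x\<close>, \<open>- x\<close> alone accounts for this bound, which meets
  the upper one when \<open>x = sqrt m\<close>.\<close>

lemma sum_mset_exp_symmetric_ge:
  fixes R :: "real multiset"
  assumes R: "image_mset uminus R = R" and x: "x \<in># R" "x \<noteq> 0"
  shows "real (size R) + 2 * (cosh x - 1) \<le> (\<Sum>x\<in>#R. exp x)"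
  unfolding sum_mset_exp_symmetric[OF R]
  using even_fun_le_sum_mset_symmetric[OF assms, of "\<lambda>x. cosh x - 1"]
  by (simp add: cosh_real_ge_1)

subsection \<open>The Estrada index of a bipartite graph\<close>

lemma adjacency_matrix_carrier [simp]:
  "adjacency_matrix G \<in> carrier_mat (card (verts G)) (card (verts G))"
  by (simp add: adjacency_matrix_def)

lemma dim_adjacency_matrix [simp]:
  "dim_row (adjacency_matrix G) = card (verts G)" "dim_col (adjacency_matrix G) = card (verts G)"
  by (simp_all add: adjacency_matrix_def)

lemma adjacency_matrix_nth:
  "i < card (verts G) \<Longrightarrow> j < card (verts G) \<Longrightarrow> adjacency_matrix G $$ (i, j) =
    of_bool ((from_nat_into (verts G) i, from_nat_into (verts G) j) \<in> arcs_ends G)"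
  by (simp add: adjacency_matrix_def)

lemma (in graph) adjacency_matrix_symmetric:
  assumes "i < card (verts G)" "j < card (verts G)"
  shows "adjacency_matrix G $$ (i, j) = adjacency_matrix G $$ (j, i)"
  using assms arcs_ends_symmetric[OF sym_arcs] by (auto simp: adjacency_matrix_nth)

lemma (in graph) arcs_ends_subset: "arcs_ends G \<subseteq> verts G \<times> verts G"
  by (auto simp: arcs_ends_conv)

lemma (in graph) finite_arcs_ends: "finite (arcs_ends G)"
  by (simp add: arcs_ends_conv)

lemma (in graph) sum_from_nat_into_verts:
  "(\<Sum>i<card (verts G). f (from_nat_into (verts G) i)) = (\<Sum>x\<in>verts G. f x)"
  by (rule sum.reindex_bij_betw) (simp add: bij_betw_from_nat_into_finite)

lemma (in graph) sum_squares_adjacency_matrix: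
  "(\<Sum>i<card (verts G). \<Sum>j<card (verts G). (adjacency_matrix G $$ (i, j))\<^sup>2) =
    real (card (arcs_ends G))"
proof -
  let ?w = "from_nat_into (verts G)"
  have "(\<Sum>i<card (verts G). \<Sum>j<card (verts G). (adjacency_matrix G $$ (i, j))\<^sup>2) =
      (\<Sum>i<card (verts G). \<Sum>j<card (verts G). of_bool ((?w i, ?w j) \<in> arcs_ends G))"
    by (intro sum.cong) (auto simp: adjacency_matrix_nth)
  also have "\<dots> = (\<Sum>x\<in>verts G. \<Sum>y\<in>verts G. of_bool ((x, y) \<in> arcs_ends G))"
    by (simp only: sum_from_nat_into_verts[of "\<lambda>y. of_bool ((x, y) \<in> arcs_ends G)" for x]
        sum_from_nat_into_verts[of "\<lambda>x. \<Sum>y\<in>verts G. of_bool ((x, y) \<in> arcs_ends G)"])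
  also have "\<dots> = (\<Sum>e\<in>verts G \<times> verts G. of_bool (e \<in> arcs_ends G))"
    by (simp only: sum.cartesian_product case_prod_unfold prod.collapse)
  also have "\<dots> = real (card (arcs_ends G))"
    using arcs_ends_subset by (simp add: of_bool_def sum.If_cases Int_absorb1)
  finally show ?thesis .
qed

text \<open>Fixes the sides that \<open>bipartite\<close> only asserts to exist. In
  \<open>arcs_ends G \<inter> U \<times> V\<close> every edge then occurs exactly once, oriented
  from \<open>U\<close> to \<open>V\<close>.\<close>

locale bipartite_graph = graph G for G :: "('a, 'b) pre_digraph" (structure) +
  fixes U V :: "'a set"
  assumes verts_eq: "verts G = U \<union> V" and disjoint: "U \<inter> V = {}"
    and arcs_ends_bipartite: "arcs_ends G \<subseteq> U \<times> V \<union> V \<times> U"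
begin

lemma finite_parts: "finite U" "finite V"
  using finite_verts by (auto simp: verts_eq)

lemma card_verts: "card (verts G) = card U + card V"
  unfolding verts_eq by (rule card_Un_disjoint[OF finite_parts disjoint])

text \<open>Conjugation by the \<open>\<plusminus>1\<close> diagonal matrix of the bipartition negates the adjacency matrix.\<close>

lemma adjacency_eigenvalues_uminus:
  "image_mset uminus (adjacency_eigenvalues G) = adjacency_eigenvalues G"
proof -
  let ?A = "adjacency_matrix G" and ?n = "card (verts G)"
  define s :: "nat \<Rightarrow> real" where "s i = (if from_nat_into (verts G) i \<in> U then 1 else -1)" for i
  let ?D = "mat_diag ?n s"
  have DD: "?D * ?D = 1\<^sub>m ?n"
    by (simp add: s_def if_distrib flip: mat_diag_one cong: if_cong)
  have "?D * ?A * ?D = - ?A"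
  proof (rule eq_matI)
    fix i j assume "i < dim_row (- ?A)" "j < dim_col (- ?A)"
    then have ij: "i < ?n" "j < ?n" by simp_all
    have "(?D * ?A * ?D) $$ (i, j) = s i * ?A $$ (i, j) * s j"
      using ij by (simp add: mat_diag_mult_left[of _ _ ?n] mat_diag_mult_right[of _ ?n])
    \<comment> \<open>A nonzero entry joins opposite sides, where the two signs multiply to
      -1.\<close>
    also have "\<dots> = (- ?A) $$ (i, j)"
      using ij disjoint arcs_ends_bipartite by (auto simp: adjacency_matrix_nth s_def)
    finally show "(?D * ?A * ?D) $$ (i, j) = (- ?A) $$ (i, j)" .
  qed (simp_all add: mat_diag_def)
  then have "similar_mat (- ?A) ?A"
    using DD by (intro similar_matI[of _ _ ?D ?D ?n]) auto
  then have "char_poly (- ?A) = char_poly ?A"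
    by (rule char_poly_similar)
  then show ?thesis
    using proots_uminus_real_symmetric[OF adjacency_matrix_carrier adjacency_matrix_symmetric]
    by (simp add: adjacency_eigenvalues_def)
qed

lemma card_arcs_ends: "card (arcs_ends G) = 2 * card (arcs_ends G \<inter> U \<times> V)"
proof -
  let ?E = "arcs_ends G \<inter> U \<times> V"
  have fin: "finite ?E" by (simp add: finite_arcs_ends)
  have "arcs_ends G = ?E \<union> ?E\<inverse>"
    using arcs_ends_bipartite arcs_ends_symmetric[OF sym_arcs] by blast
  moreover have "?E \<inter> ?E\<inverse> = {}"
    using disjoint by blast
  ultimately have "card (arcs_ends G) = card ?E + card (?E\<inverse>)"
    using card_Un_disjoint[of ?E "?E\<inverse>"] fin by simp
  then show ?thesis by simp
qed

lemma size_adjacency_eigenvalues: "size (adjacency_eigenvalues G) = card (verts G)"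
  unfolding adjacency_eigenvalues_def
  by (rule size_proots_real_symmetric[OF adjacency_matrix_carrier adjacency_matrix_symmetric])

lemma sum_squares_adjacency_eigenvalues:
  "(\<Sum>x\<in>#adjacency_eigenvalues G. x\<^sup>2) = 2 * real (card (arcs_ends G \<inter> U \<times> V))"
  unfolding adjacency_eigenvalues_def
  by (subst sum_squares_proots_real_symmetric[OF adjacency_matrix_carrier adjacency_matrix_symmetric])
    (simp_all add: sum_squares_adjacency_matrix card_arcs_ends)

lemma estrada_index_le:
  "estrada_index G \<le>
    real (card (verts G)) + 2 * (cosh (sqrt (card (arcs_ends G \<inter> U \<times> V))) - 1)"
  unfolding estrada_index_def size_adjacency_eigenvalues[symmetric]
  by (rule sum_mset_exp_symmetric_le)
    (fact adjacency_eigenvalues_uminus sum_squares_adjacency_eigenvalues)+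

text \<open>The upper bound is the general one. For the lower bound it suffices that
  \<open>sqrt (card U * card V)\<close> is an eigenvalue.\<close>

lemma estrada_index_complete_bipartite:
  assumes complete: "arcs_ends G = U \<times> V \<union> V \<times> U" and ne: "U \<noteq> {}" "V \<noteq> {}"
  shows "estrada_index G =
    real (card (verts G)) + 2 * (cosh (sqrt (card U * card V)) - 1)"
proof (rule antisym)
  have "arcs_ends G \<inter> U \<times> V = U \<times> V"
    by (auto simp: complete)
  with estrada_index_le show "estrada_index G \<le>
      real (card (verts G)) + 2 * (cosh (sqrt (card U * card V)) - 1)"
    by (simp add: card_cartesian_product)
next
  let ?n = "card (verts G)" and ?w = "from_nat_into (verts G)" and ?A = "adjacency_matrix G"
  let ?l = "sqrt (card U * card V)"
  have pos: "card U > 0" "card V > 0"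
    using ne finite_parts by (auto simp: card_gt_0_iff)
  then have l: "?l \<noteq> 0" by simp
  have w: "?w i \<in> U \<union> V" if "i < ?n" for i
    using bij_betw_from_nat_into_finite[OF finite_verts] that verts_eq
    by (auto simp: bij_betw_def)
  \<comment> \<open>An eigenvector constant on each side: over the neighbours of a vertex in
    \<open>U\<close> it sums to \<open>card V * sqrt (card U)\<close>, which is
    \<open>?l * sqrt (card V)\<close>, and symmetrically on \<open>V\<close>.\<close>
  define f where "f x = (if x \<in> U then sqrt (card V) else sqrt (card U))" for x
  define v where "v = vec ?n (\<lambda>i. f (?w i))"
  have sum: "(\<Sum>y\<in>verts G. of_bool ((x, y) \<in> arcs_ends G) * f y) = ?l * f x"
    if "x \<in> U \<union> V" for x
  proof (cases "x \<in> U")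
    case True
    have "(\<Sum>y\<in>verts G. of_bool ((x, y) \<in> arcs_ends G) * f y) = (\<Sum>y\<in>V. sqrt (card U))"
      using True disjoint finite_parts
      by (intro sum.mono_neutral_cong_right) (auto simp: verts_eq complete f_def)
    then show ?thesis
      using True by (simp add: f_def real_sqrt_mult)
  next
    case False
    have "(\<Sum>y\<in>verts G. of_bool ((x, y) \<in> arcs_ends G) * f y) = (\<Sum>y\<in>U. sqrt (card V))"
      using that False disjoint finite_parts
      by (intro sum.mono_neutral_cong_right) (auto simp: verts_eq complete f_def)
    then show ?thesis
      using False by (simp add: f_def real_sqrt_mult)
  qed
  have "?A *\<^sub>v v = ?l \<cdot>\<^sub>v v"
  proof (rule eq_vecI)
    fix i assume "i < dim_vec (?l \<cdot>\<^sub>v v)"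
    then have i: "i < ?n" by (simp add: v_def)
    have "(?A *\<^sub>v v) $ i = (\<Sum>j<?n. ?A $$ (i, j) * v $ j)"
      using i by (simp add: scalar_prod_def atLeast0LessThan v_def)
    also have "\<dots> = (\<Sum>j<?n. of_bool ((?w i, ?w j) \<in> arcs_ends G) * f (?w j))"
      using i by (intro sum.cong) (auto simp: adjacency_matrix_nth v_def)
    also have "\<dots> = (\<Sum>y\<in>verts G. of_bool ((?w i, y) \<in> arcs_ends G) * f y)"
      by (rule sum_from_nat_into_verts)
    also have "\<dots> = ?l * f (?w i)"
      by (rule sum[OF w[OF i]])
    also have "\<dots> = (?l \<cdot>\<^sub>v v) $ i"
      using i by (simp add: v_def)
    finally show "(?A *\<^sub>v v) $ i = (?l \<cdot>\<^sub>v v) $ i" .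
  qed (simp add: v_def)
  moreover have "v \<noteq> 0\<^sub>v ?n"
  proof
    assume "v = 0\<^sub>v ?n"
    moreover have "0 < ?n" using pos card_verts by simp
    ultimately have "f (?w 0) = 0"
      by (metis index_vec index_zero_vec(1) v_def)
    with pos show False by (auto simp: f_def split: if_splits)
  qed
  ultimately have "eigenvalue ?A ?l"
    unfolding eigenvalue_def eigenvector_def
    by (intro exI[of _ v]) (auto simp: v_def)
  moreover have "char_poly ?A \<noteq> 0"
    using degree_monic_char_poly[OF adjacency_matrix_carrier[of G]] by auto
  ultimately have "?l \<in># adjacency_eigenvalues G"
    unfolding adjacency_eigenvalues_def
    using eigenvalue_root_char_poly[OF adjacency_matrix_carrier[of G]] by simp
  from sum_mset_exp_symmetric_ge[OF adjacency_eigenvalues_uminus this l]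
  show "real (card (verts G)) + 2 * (cosh ?l - 1) \<le> estrada_index G"
    unfolding estrada_index_def size_adjacency_eigenvalues .
qed

end

subsection \<open>Edges and the matching number\<close>

text \<open>
  Numbering the two sides, the pairs with a given sum of numbers modulo \<open>k\<close> form a matching,
  so \<open>U \<times> V\<close> is covered by \<open>k\<close> matchings.
\<close>

lemma card_le_mult_if_partial_injections_le:
  fixes U :: "'a set" and V :: "'b set"
  assumes fin: "finite U" "finite V" and E: "E \<subseteq> U \<times> V"
    and k: "card U \<le> k" "card V \<le> k"
    and p: "\<And>F. F \<subseteq> E \<Longrightarrow> inj_on fst F \<Longrightarrow> inj_on snd F \<Longrightarrow> card F \<le> p"
  shows "card E \<le> k * p"
proof -
  obtain f where f: "bij_betw f U {0..<card U}"
    using ex_bij_betw_finite_nat[OF fin(1)] by blast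
  obtain g where g: "bij_betw g V {0..<card V}"
    using ex_bij_betw_finite_nat[OF fin(2)] by blast
  have f_less: "f x < k" if "x \<in> U" for x
    using bij_betwE[OF f] that k by fastforce
  have g_less: "g y < k" if "y \<in> V" for y
    using bij_betwE[OF g] that k by fastforce
  \<comment> \<open>Within one class of \<open>h\<close>, either end of a pair determines the other;
    this is where \<open>k\<close> must bound both sides.\<close>
  have cancel: "a = b" if "(c + a) mod k = (c + b) mod k" "a < k" "b < k" for a b c :: nat
    using that by (metis cong_add_lcancel_nat cong_def mod_less)
  define h where "h e = (f (fst e) + g (snd e)) mod k" for e
  have finE: "finite E"
    using finite_subset[OF E] fin by simp
  have "card {e \<in> E. h e = c} \<le> p" for c
  proof (rule p)
    show "inj_on fst {e \<in> E. h e = c}"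
    proof (rule inj_onI)
      fix e e' assume e: "e \<in> {e \<in> E. h e = c}" "e' \<in> {e \<in> E. h e = c}" "fst e = fst e'"
      then have V: "snd e \<in> V" "snd e' \<in> V" using E by auto
      have "(f (fst e) + g (snd e)) mod k = (f (fst e) + g (snd e')) mod k"
        using e by (simp add: h_def)
      then have "g (snd e) = g (snd e')"
        by (rule cancel) (simp_all add: g_less V)
      then show "e = e'"
        using e(3) V bij_betw_imp_inj_on[OF g] by (auto simp: prod_eq_iff dest: inj_onD)
    qed
    show "inj_on snd {e \<in> E. h e = c}"
    proof (rule inj_onI)
      fix e e' assume e: "e \<in> {e \<in> E. h e = c}" "e' \<in> {e \<in> E. h e = c}" "snd e = snd e'"
      then have U: "fst e \<in> U" "fst e' \<in> U" using E by auto
      have "(g (snd e) + f (fst e)) mod k = (g (snd e) + f (fst e')) mod k"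
        using e by (simp add: h_def add.commute)
      then have "f (fst e) = f (fst e')"
        by (rule cancel) (simp_all add: f_less U)
      then show "e = e'"
        using e(3) U bij_betw_imp_inj_on[OF f] by (auto simp: prod_eq_iff dest: inj_onD)
    qed
  qed auto
  then have "(\<Sum>c<k. card {e \<in> E. h e = c}) \<le> k * p"
    using sum_bounded_above[of "{..<k}" "\<lambda>c. card {e \<in> E. h e = c}" p] by simp
  moreover have "card E = (\<Sum>c<k. card {e \<in> E. h e = c})"
  proof -
    \<comment> \<open>An element of \<open>E\<close> forces \<open>k > 0\<close>; reduction modulo 0
      would be the identity.\<close>
    have "h e < k" if "e \<in> E" for e
      unfolding h_def using f_less[of "fst e"] E that by (intro mod_less_divisor) auto
    then have "E = (\<Union>c<k. {e \<in> E. h e = c})" by auto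
    then have "card E = card (\<Union>c<k. {e \<in> E. h e = c})" by simp
    also have "\<dots> = (\<Sum>c<k. card {e \<in> E. h e = c})"
      using finE by (intro card_UN_disjoint) auto
    finally show ?thesis .
  qed
  ultimately show ?thesis by simp
qed

context graph
begin

lemma finite_edges: "finite (edges G)"
proof -
  have "edges G = (\<lambda>(u, v). {u, v}) ` arcs_ends G"
    by (auto simp: edges_def)
  then show ?thesis by (simp add: finite_arcs_ends)
qed

text \<open>Together with the empty matching, this makes the \<open>Max\<close> in
  \<open>matching_number\<close> an attained maximum.\<close>

lemma finite_card_matchings: "finite {card M | M. matching G M}"
proof -
  have "{card M | M. matching G M} \<subseteq> card ` Pow (edges G)"
    by (auto simp: matching_def)
  then show ?thesis
    by (rule finite_subset) (simp add: finite_edges)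
qed

lemma card_le_matching_number: "matching G M \<Longrightarrow> card M \<le> matching_number G"
  unfolding matching_number_def by (rule Max_ge[OF finite_card_matchings]) auto

lemma maximum_matching_exists:
  obtains M where "matching G M" "card M = matching_number G"
proof -
  have "matching G {}" by (simp add: matching_def)
  then have "{card M | M. matching G M} \<noteq> {}" by blast
  from Max_in[OF finite_card_matchings this] show ?thesis
    using that unfolding matching_number_def by auto
qed

end

context bipartite_graph
begin

lemma flip: "bipartite_graph G V U"
  using verts_eq disjoint arcs_ends_bipartite by unfold_locales auto

text \<open>Every edge has an end in \<open>U\<close>; choosing one for each edge of
  \<open>M\<close> is injective since the edges are disjoint.\<close>

lemma card_matching_le: assumes "matching G M" shows "card M \<le> card U"
proof -
  have ex: "\<exists>u. u \<in> e \<inter> U" if "e \<in> M" for e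
  proof -
    have "e \<in> edges G" using assms that by (auto simp: matching_def)
    then obtain u v where "e = {u, v}" "(u, v) \<in> arcs_ends G" by (auto simp: edges_def)
    then show ?thesis using arcs_ends_bipartite by auto
  qed
  define r where "r e = (SOME u. u \<in> e \<inter> U)" for e
  have r: "r e \<in> e" "r e \<in> U" if "e \<in> M" for e
    using someI_ex[OF ex[OF that]] by (auto simp: r_def)
  have "inj_on r M"
  proof (rule inj_onI)
    fix e e' assume e: "e \<in> M" "e' \<in> M" "r e = r e'"
    then have "\<not> disjnt e e'"
      using r(1)[of e] r(1)[of e'] by (auto simp: disjnt_iff)
    then show "e = e'"
      using assms e by (auto simp: matching_def pairwise_def)
  qed
  then show ?thesis
    by (rule card_inj_on_le) (use r finite_parts in auto)
qed

lemma matching_number_le_part: "matching_number G \<le> card U"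
  by (metis maximum_matching_exists card_matching_le)

text \<open>As \<open>U\<close> and \<open>V\<close> are disjoint, two edges can meet only in their
  \<open>U\<close>-ends or in their \<open>V\<close>-ends, and injectivity of the projections
  excludes both for distinct pairs.\<close>

lemma card_partial_injection_le_matching_number:
  assumes F: "F \<subseteq> arcs_ends G \<inter> U \<times> V" and inj: "inj_on fst F" "inj_on snd F"
  shows "card F \<le> matching_number G"
proof -
  let ?h = "\<lambda>(u, v). {u, v}"
  have eq: "e = e'" if "e \<in> F" "e' \<in> F" "\<not> disjnt (?h e) (?h e')" for e e'
  proof -
    have "fst e \<in> U" "fst e' \<in> U" "snd e \<in> V" "snd e' \<in> V" using F that by auto
    then have "fst e = fst e' \<or> snd e = snd e'"
      using that(3) disjoint by (auto simp: case_prod_unfold disjnt_iff)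
    then show ?thesis using inj that by (auto dest: inj_onD)
  qed
  have "matching G (?h ` F)"
    unfolding matching_def
  proof
    show "?h ` F \<subseteq> edges G" using F by (auto simp: edges_def)
    show "pairwise disjnt (?h ` F)"
      unfolding pairwise_image by (rule pairwiseI) (use eq in blast)
  qed
  moreover have "inj_on ?h F"
    by (intro inj_onI eq) (auto simp: disjnt_iff)
  ultimately show ?thesis
    using card_le_matching_number by (metis card_image)
qed

lemma card_edges_le:
  "card (arcs_ends G \<inter> U \<times> V) \<le> max (card U) (card V) * matching_number G"
  by (rule card_le_mult_if_partial_injections_le[OF finite_parts])
    (auto intro: card_partial_injection_le_matching_number)

text \<open>Each side has at least \<open>matching_number G\<close> vertices, which bounds the
  larger side by the remaining number.\<close>

lemma card_edges_le_matching_number: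
  "card (arcs_ends G \<inter> U \<times> V) \<le> matching_number G * (card (verts G) - matching_number G)"
proof -
  have "max (card U) (card V) \<le> card (verts G) - matching_number G"
    using matching_number_le_part bipartite_graph.matching_number_le_part[OF flip] card_verts by simp linarith
  then show ?thesis
    using card_edges_le by (metis mult.commute mult_le_mono1 order_trans)
qed

lemma complete_bipartite_if_card_edges_eq:
  assumes eq: "card (arcs_ends G \<inter> U \<times> V) = matching_number G * (card (verts G) - matching_number G)"
    and pos: "matching_number G > 0"
  shows "complete_bipartite_digraph (matching_number G) (card (verts G) - matching_number G) G"
proof -
  let ?p = "matching_number G"
  have le: "?p \<le> card U" "?p \<le> card V"
    using matching_number_le_part bipartite_graph.matching_number_le_part[OF flip] by auto
  \<comment> \<open>The positive factor \<open>?p\<close> is cancelled. With both sides of size at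
    least \<open>?p\<close>, this fixes their sizes up to exchange.\<close>
  have "card (verts G) - ?p \<le> max (card U) (card V)"
    using card_edges_le eq pos by (simp add: mult.commute)
  then have parts: "card U = ?p \<and> card V = card (verts G) - ?p \<or> card V = ?p \<and> card U = card (verts G) - ?p"
    using le card_verts by linarith
  then have "card (arcs_ends G \<inter> U \<times> V) = card (U \<times> V)"
    using eq by (auto simp: card_cartesian_product)
  then have "arcs_ends G \<inter> U \<times> V = U \<times> V"
    using finite_parts by (intro card_subset_eq) auto
  then have UV: "U \<times> V \<subseteq> arcs_ends G" by auto
  have "V \<times> U \<subseteq> arcs_ends G"
    using UV arcs_ends_symmetric[OF sym_arcs] by auto
  with UV have "arcs_ends G = U \<times> V \<union> V \<times> U"
    using arcs_ends_bipartite by auto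
  then show ?thesis
    unfolding complete_bipartite_digraph_def using parts verts_eq disjoint graph_axioms
    by (metis Un_commute Int_commute)
qed

text \<open>An injection of \<open>U\<close> into \<open>V\<close> is a matching that covers
  \<open>U\<close>.\<close>

lemma complete_bipartite_matching_number:
  assumes complete: "arcs_ends G = U \<times> V \<union> V \<times> U" and le: "card U \<le> card V"
  shows "matching_number G = card U"
proof (rule antisym)
  obtain f where f: "f ` U \<subseteq> V" "inj_on f U"
    using card_le_inj[OF finite_parts le] by blast
  let ?F = "(\<lambda>u. (u, f u)) ` U"
  have "card ?F \<le> matching_number G"
    using f complete
    by (intro card_partial_injection_le_matching_number) (auto simp: inj_on_def)
  then show "card U \<le> matching_number G"
    by (simp add: card_image inj_on_def)
qed (rule matching_number_le_part)

end

subsection \<open>Complete bipartite graphs\<close>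

lemma complete_bipartite_digraphE:
  assumes "complete_bipartite_digraph a b G"
  obtains U V where "bipartite_graph G U V" "card U = a" "card V = b"
    "arcs_ends G = U \<times> V \<union> V \<times> U"
proof -
  from assms obtain U V where "graph G" and UV: "verts G = U \<union> V" "U \<inter> V = {}"
    "card U = a" "card V = b" "arcs_ends G = U \<times> V \<union> V \<times> U"
    unfolding complete_bipartite_digraph_def by blast
  from \<open>graph G\<close> interpret graph G .
  have "bipartite_graph G U V"
    using UV by unfold_locales auto
  with UV show ?thesis by (intro that) auto
qed

text \<open>Without parallel arcs an arc is determined by its ends, so a vertex bijection that
  respects adjacency induces the bijection of arcs.\<close>

lemma (in graph) digraph_iso_if_arcs_ends_eq_image:
  assumes H: "graph H" and f: "inj_on f (verts G)" "f ` verts G = verts H"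
    and ends: "arcs_ends H = map_prod f f ` arcs_ends G"
  shows "digraph_iso G H"
proof -
  interpret H: graph H by fact
  \<comment> \<open>The unique arc of \<open>H\<close> between the images of the ends of
    \<open>a\<close>.\<close>
  define h where "h a = the_inv_into (arcs H) (arc_to_ends H) (map_prod f f (arc_to_ends G a))" for a
  have injH: "inj_on (arc_to_ends H) (arcs H)"
    by (rule inj_onI) (rule H.no_multi_arcs)
  have im: "map_prod f f (arc_to_ends G a) \<in> arc_to_ends H ` arcs H" if "a \<in> arcs G" for a
    using that ends by (auto simp: arcs_ends_def)
  have h: "h a \<in> arcs H" "arc_to_ends H (h a) = map_prod f f (arc_to_ends G a)" if "a \<in> arcs G" for a
    unfolding h_def
    by (rule the_inv_into_into[OF injH im[OF that] order_refl], rule f_the_inv_into_f[OF injH im[OF that]])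
  have "inj_on h (arcs G)"
  proof (rule inj_onI)
    fix a b assume ab: "a \<in> arcs G" "b \<in> arcs G" "h a = h b"
    then have "map_prod f f (arc_to_ends G a) = map_prod f f (arc_to_ends G b)"
      using h(2) by metis
    then have "arc_to_ends G a = arc_to_ends G b"
      using ab f(1) by (auto simp: arc_to_ends_def dest: inj_onD)
    then show "a = b" using ab no_multi_arcs by blast
  qed
  moreover have "h ` arcs G = arcs H"
  proof
    show "arcs H \<subseteq> h ` arcs G"
    proof
      fix b assume b: "b \<in> arcs H"
      then have "arc_to_ends H b \<in> map_prod f f ` arcs_ends G"
        unfolding ends[symmetric] by (simp add: arcs_ends_def)
      then obtain e where e: "e \<in> arcs_ends G" "arc_to_ends H b = map_prod f f e"
        by (rule imageE)
      from e(1) obtain a where "a \<in> arcs G" "e = arc_to_ends G a"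
        unfolding arcs_ends_def by (rule imageE)
      with e(2) have a: "a \<in> arcs G" "arc_to_ends H b = map_prod f f (arc_to_ends G a)"
        by simp_all
      then have "h a = b"
        using injH b h[OF a(1)] by (metis inj_onD)
      with a(1) show "b \<in> h ` arcs G" by blast
    qed
  qed (use h in auto)
  \<comment> \<open>\<open>app_iso\<close> takes its head and tail functions from the isomorphism
    record; inserting those of \<open>H\<close> yields \<open>H\<close> itself.\<close>
  ultimately show ?thesis
    unfolding digraph_iso_def digraph_isomorphism_def
    using f h(2) wf_digraph
    by (intro exI[of _ "\<lparr>iso_verts = f, iso_arcs = h, iso_head = head H, iso_tail = tail H\<rparr>"])
      (auto simp: app_iso_def arc_to_ends_def)
qed

lemma complete_bipartite_digraph_iso:
  assumes "complete_bipartite_digraph a b G" "complete_bipartite_digraph a b H"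
  shows "digraph_iso G H"
proof -
  obtain U V where G: "bipartite_graph G U V" "card U = a" "card V = b"
      "arcs_ends G = U \<times> V \<union> V \<times> U"
    using complete_bipartite_digraphE[OF assms(1)] by blast
  obtain U' V' where H: "bipartite_graph H U' V'" "card U' = a" "card V' = b"
      "arcs_ends H = U' \<times> V' \<union> V' \<times> U'"
    using complete_bipartite_digraphE[OF assms(2)] by blast
  interpret G: bipartite_graph G U V by fact
  interpret H: bipartite_graph H U' V' by fact
  obtain g where g: "bij_betw g U U'"
    using finite_same_card_bij[OF G.finite_parts(1) H.finite_parts(1)] G(2) H(2) by auto
  obtain h where h: "bij_betw h V V'"
    using finite_same_card_bij[OF G.finite_parts(2) H.finite_parts(2)] G(3) H(3) by auto
  define f where "f x = (if x \<in> U then g x else h x)" for x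
  have fU: "bij_betw f U U'"
    using g by (subst bij_betw_cong[of _ _ g]) (auto simp: f_def)
  have fV: "bij_betw f V V'"
    using h G.disjoint by (subst bij_betw_cong[of _ _ h]) (auto simp: f_def)
  have f: "bij_betw f (U \<union> V) (U' \<union> V')"
    by (rule bij_betw_combine[OF fU fV H.disjoint])
  have "map_prod f f ` arcs_ends G = arcs_ends H"
    unfolding G(4) H(4) image_Un map_prod_surj_on[OF bij_betw_imp_surj_on[OF fU] bij_betw_imp_surj_on[OF fV]]
      map_prod_surj_on[OF bij_betw_imp_surj_on[OF fV] bij_betw_imp_surj_on[OF fU]] ..
  then show ?thesis
    using f by (intro G.digraph_iso_if_arcs_ends_eq_image[of H f])
      (auto simp: G.verts_eq H.verts_eq bij_betw_def H.graph_axioms)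
qed

lemma (in graph) card_arcs_ends_eq_card_arcs: "card (arcs_ends G) = card (arcs G)"
  unfolding arcs_ends_def by (intro card_image inj_onI no_multi_arcs)

text \<open>The invariant by which a graph isomorphic to \<open>K\<close> is seen to attain the edge
  bound.\<close>

lemma digraph_iso_card_arcs: "digraph_iso G H \<Longrightarrow> card (arcs G) = card (arcs H)"
  by (auto simp: digraph_iso_def pre_digraph.digraph_isomorphism_def card_image)

lemma bipartite_graph_iff_exists:
  "graph G \<and> bipartite G \<longleftrightarrow> (\<exists>U V. bipartite_graph G U V)"
  by (auto simp: bipartite_def bipartite_graph_def bipartite_graph_axioms_def)

lemma estrada_index_complete_bipartite_digraph:
  assumes "complete_bipartite_digraph a b G" "0 < a" "0 < b"
  shows "estrada_index G = real (a + b) + 2 * (cosh (sqrt (a * b)) - 1)"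
proof -
  obtain U V where G: "bipartite_graph G U V" "card U = a" "card V = b"
      "arcs_ends G = U \<times> V \<union> V \<times> U"
    using complete_bipartite_digraphE[OF assms(1)] by blast
  have "U \<noteq> {}" "V \<noteq> {}" using G assms by auto
  from bipartite_graph.estrada_index_complete_bipartite[OF G(1,4) this] show ?thesis
    by (simp add: G bipartite_graph.card_verts[OF G(1)])
qed

text \<open>Membership of \<open>K\<close> is conditional because for \<open>2 * p > n\<close> the
  class is empty: both sides of a member have at least \<open>p\<close> vertices. The types of
  \<open>G\<close> and \<open>K\<close> may differ.\<close>

theorem theorem3p3:
  fixes n p :: nat
    and K :: "('c, 'd) pre_digraph"
  assumes "n \<ge> 2" and "p \<ge> 1"
    and "complete_bipartite_digraph p (n - p) K"
  shows "(2 * p \<le> n \<longrightarrow> K \<in> bipartite_graphs_matching n p) \<and>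
    (\<forall>G \<in> (bipartite_graphs_matching n p :: ('a, 'b) pre_digraph set).
       estrada_index G \<le> estrada_index K \<and>
       (estrada_index G = estrada_index K \<longleftrightarrow> digraph_iso G K))"
proof (intro conjI ballI impI)
  obtain U V where K: "bipartite_graph K U V" "card U = p" "card V = n - p"
      "arcs_ends K = U \<times> V \<union> V \<times> U"
    using complete_bipartite_digraphE[OF assms(3)] by blast
  interpret K: bipartite_graph K U V by fact
  \<comment> \<open>The assumption makes the side of size \<open>p\<close> the smaller one.\<close>
  show "K \<in> bipartite_graphs_matching n p" if "2 * p \<le> n"
    using K.complete_bipartite_matching_number[OF K(4)] K that K.card_verts
      bipartite_graph_iff_exists[of K] by (auto simp: bipartite_graphs_matching_def)

  fix G :: "('a, 'b) pre_digraph"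
  assume "G \<in> bipartite_graphs_matching n p"
  then obtain X Y where G: "bipartite_graph G X Y" "card (verts G) = n" "matching_number G = p"
    using bipartite_graph_iff_exists[of G] by (auto simp: bipartite_graphs_matching_def)
  interpret G: bipartite_graph G X Y by fact
  let ?m = "card (arcs_ends G \<inter> X \<times> Y)"
  have "p \<le> card X" "p \<le> card Y"
    using G.matching_number_le_part bipartite_graph.matching_number_le_part[OF G.flip] G(3) by auto
  then have p: "2 * p \<le> n" using G.card_verts G(2) by simp
  have m: "?m \<le> p * (n - p)"
    using G.card_edges_le_matching_number G by simp
  have np: "0 < n - p" using p assms(1,2) by linarith
  have EE_K: "estrada_index K = real n + 2 * (cosh (sqrt (p * (n - p))) - 1)"
    using estrada_index_complete_bipartite_digraph[OF assms(3)] np p assms(2) by simp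
  \<comment> \<open>The equivalence serves twice: forwards to recover edge counts in the equality
    case, backwards for the bound.\<close>
  have cosh_iff: "cosh (sqrt (real a)) \<le> cosh (sqrt (real b)) \<longleftrightarrow> a \<le> b" for a b
    by (simp add: cosh_real_nonneg_le_iff)
  have upper: "estrada_index G \<le> real n + 2 * (cosh (sqrt ?m) - 1)"
    using G.estrada_index_le G(2) by simp
  also have "\<dots> \<le> estrada_index K"
    using cosh_iff m unfolding EE_K by (simp del: of_nat_mult)
  finally show "estrada_index G \<le> estrada_index K" .
  show "estrada_index G = estrada_index K \<longleftrightarrow> digraph_iso G K"
  proof
    assume "estrada_index G = estrada_index K"
    with upper have "p * (n - p) \<le> ?m"
      unfolding EE_K by (simp add: cosh_iff del: of_nat_mult)
    then have "complete_bipartite_digraph p (n - p) G"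
      using m G.complete_bipartite_if_card_edges_eq G assms(2) by simp
    then show "digraph_iso G K"
      using assms(3) by (rule complete_bipartite_digraph_iso)
  next
    \<comment> \<open>Equal arc counts give \<open>G\<close> the maximal number of edges, so
      \<open>G\<close> is complete bipartite itself and the explicit formula applies to both
      graphs.\<close>
    assume "digraph_iso G K"
    then have "card (arcs_ends G) = card (arcs_ends K)"
      by (simp add: digraph_iso_card_arcs G.card_arcs_ends_eq_card_arcs K.card_arcs_ends_eq_card_arcs)
    moreover have "arcs_ends K \<inter> U \<times> V = U \<times> V" using K(4) by auto
    ultimately have "?m = p * (n - p)"
      using G.card_arcs_ends K.card_arcs_ends K by (simp add: card_cartesian_product)
    then have "complete_bipartite_digraph p (n - p) G"
      using G.complete_bipartite_if_card_edges_eq G assms(2) by simp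
    from estrada_index_complete_bipartite_digraph[OF this] show "estrada_index G = estrada_index K"
      using estrada_index_complete_bipartite_digraph[OF assms(3)] np assms(2) by simp
  qed
qed

end
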